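(* The right discrete Hamilton--Jacobi equation $$S_{\rm d}^{k+1}(f^{+}_{k}(q))-S_{\rm d}^{k}(q)-DS_{\rm d}^{k+1}(f^{+}_{k}(q))\cdot f^{+}_{k}(q)+H_{\rm d}^{+}\big(q,DS_{\rm d}^{k+1}(f^{+}_{k}(q))\big)=0,$$ applied to the Hamiltonian formulation (described in the context) of the standard discrete optimal control problem $$\min_{u_{\rm d}}\sum_{k=0}^{N-1}C_{\rm d}(q_k,u_k)\quad\text{subject to}\quad q_{k+1}=f_{\rm d}(q_k,u_k),$$ gives the Bellman equation for the optimal discrete cost-to-go function $J_{\rm d}^{k}=S_{\rm d}^{*}-S_{\rm d}^{k}$: $$\min_{u_k}\left[J_{\rm d}^{k+1}(f_{\rm d}(q_k,u_k))+C_{\rm d}(q_k,u_k)\right]=J_{\rm d}^{k}(q_k).$$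
   Context: Setting: $q_{\rm d}=\{q_k\}_{k=0}^{N}$ are state variables in a vector space $V\cong\mathbb{R}^n$ with $q_0$ and $q_N$ fixed; $u_{\rm d}=\{u_k\}_{k=0}^{N-1}$ are controls in a set $\mathcal{U}\subset\mathbb{R}^m$; $C_{\rm d}:V\times\mathcal{U}\to\mathbb{R}$ and $f_{\rm d}:V\times\mathcal{U}\to V$ are given functions. $D_i$ is the derivative in the $i$-th argument, $D$ the derivative of a function of one argument, and $\cdot$ the pairing of $V^*$ with $V$. Hamiltonian formulation: with costates $p_{\rm d}=\{p_k\}_{k=1}^{N}$, $p_k\in V^*$, the discrete control Hamiltonian is $$\hat H_{\rm d}^{+}(q_k,p_{k+1},u_k)=p_{k+1}\cdot f_{\rm d}(q_k,u_k)-C_{\rm d}(q_k,u_k),$$ and the augmented discrete cost functional is $$\hat S_{\rm d}(q_{\rm d},p_{\rm d},u_{\rm d})=\sum_{k=0}^{N-1}\left[p_{k+1}\cdot q_{k+1}-\hat H_{\rm d}^{+}(q_k,p_{k+1},u_k)\right].$$ It is assumed that $\hat H_{\rm d}^{+}$ is sufficiently regular that $D_3\hat H_{\rm d}^{+}(q_k,p_{k+1},u_k)=0$, $k=0,\dots,N-1$, uniquely determines the optimal control $u_{\rm d}^*=\{u_k^*\}_{k=0}^{N-1}$, $u_k^*=u_k^*(q_k,p_{k+1})$, and one sets $$H_{\rm d}^{+}(q_k,p_{k+1})=\max_{u_k}\hat H_{\rm d}^{+}(q_k,p_{k+1},u_k)=p_{k+1}\cdot f_{\rm d}(q_k,u_k^*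 )-C_{\rm d}(q_k,u_k^* ).$$ The action sums are $$S_{\rm d}^{k}(q_k)=\sum_{l=0}^{k-1}\left[p_{l+1}\cdot q_{l+1}-H_{\rm d}^{+}(q_l,p_{l+1})\right]$$ (evaluated along a solution of the right discrete Hamilton's equations $q_{k+1}=D_2H_{\rm d}^{+}(q_k,p_{k+1})$, $p_k=D_1H_{\rm d}^{+}(q_k,p_{k+1})$ and seen as functions of the end point $q_k$ and the discrete end time $k$), the optimal discrete cost functional is $S_{\rm d}^{*}=\hat S_{\rm d}(q_{\rm d},p_{\rm d},u_{\rm d}^* )=\sum_{k=0}^{N-1}[p_{k+1}\cdot q_{k+1}-H_{\rm d}^{+}(q_k,p_{k+1})]$, and the optimal discrete cost-to-go function is $$J_{\rm d}^{k}(q_k)=\sum_{l=k}^{N-1}\left\{C_{\rm d}(q_l,u_l^* )+p_{l+1}\cdot\left[q_{l+1}-f_{\rm d}(q_l,u_l^* )\right]\right\}=\sum_{l=k}^{N-1}\left[p_{l+1}\cdot q_{l+1}-H_{\rm d}^{+}(q_l,p_{l+1})\right]=S_{\rm d}^{*}-S_{\rm d}^{k}(q_k).$$ The map $f_k^{+}$ in the right discrete Hamilton--Jacobi equation is defined implicitly by $f_k^{+}(q_k)=D_2H_{\rm d}^{+}\big(q_k,DS_{\rm d}^{k+1}(f_k^{+}(q_k))\big)$ (assumed solvable), which here reads $f_k^{+}(q_k)=f_{\rm d}\big(q_k,u_k^*(q_k,DS_{\rm d}^{k+1}(f_k^{+}(q_k)))\big)$.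
   Formalization: The solutions of Hamilton's equations defining S_d^k(q_k) are assumed to have globally optimal controls for fixed end points q_0, q_k, for every k and reachable q_k; with stationarity and maximality of the control Hamiltonian alone the Bellman equation can fail. *)

theory Defs
  imports "HOL-Analysis.Analysis"
begin

(* V is a Euclidean space 'v, controls live in a set U of a Euclidean space 'u, and V* is the
   normed dual below, with blinfun_apply as the pairing of V* with V.  A covector-valued or
   vector-valued sequence indexed by 0..N (or 1..N) is a function on nat of which only those
   values are used. *)

type_synonym 'v dual = "'v \<Rightarrow>\<^sub>L real"

definition D :: "('v::euclidean_space \<Rightarrow> real) \<Rightarrow> 'v \<Rightarrow> 'v dual" where
  "D g x = Blinfun (frechet_derivative g (at x))"

subsection \<open>The discrete optimal control problem\<close>

definition admissible ::
  "('v \<Rightarrow> 'u \<Rightarrow> 'v) \<Rightarrow> 'u set \<Rightarrow> nat \<Rightarrow> (nat \<Rightarrow> 'v) \<Rightarrow> (nat \<Rightarrow> 'u) \<Rightarrow> bool" where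
  "admissible fd U N q u \<longleftrightarrow> (\<forall>k<N. u k \<in> U \<and> q (Suc k) = fd (q k) (u k))"

definition total_cost ::
  "('v \<Rightarrow> 'u \<Rightarrow> real) \<Rightarrow> nat \<Rightarrow> (nat \<Rightarrow> 'v) \<Rightarrow> (nat \<Rightarrow> 'u) \<Rightarrow> real" where
  "total_cost Cd N q u = (\<Sum>k<N. Cd (q k) (u k))"

(* Both end points of the trajectory are held fixed in the comparison. *)
definition optimal ::
  "('v \<Rightarrow> 'u \<Rightarrow> real) \<Rightarrow> ('v \<Rightarrow> 'u \<Rightarrow> 'v) \<Rightarrow> 'u set \<Rightarrow> nat \<Rightarrow> (nat \<Rightarrow> 'v) \<Rightarrow> (nat \<Rightarrow> 'u) \<Rightarrow> bool" where
  "optimal Cd fd U N q u \<longleftrightarrow> admissible fd U N q u \<and>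
     (\<forall>q' u'. admissible fd U N q' u' \<and> q' 0 = q 0 \<and> q' N = q N
        \<longrightarrow> total_cost Cd N q u \<le> total_cost Cd N q' u')"

(* The possible values of the state q_k when q_0 is fixed; this is the natural domain of the
   action sum at time k, e.g. only {q0} for k = 0. *)
definition reachable :: "('v \<Rightarrow> 'u \<Rightarrow> 'v) \<Rightarrow> 'u set \<Rightarrow> 'v \<Rightarrow> nat \<Rightarrow> 'v set" where
  "reachable fd U q0 k = {x. \<exists>q u. admissible fd U k q u \<and> q 0 = q0 \<and> q k = x}"

subsection \<open>Hamiltonian formulation\<close>

definition H_hat ::
  "('v::euclidean_space \<Rightarrow> 'u \<Rightarrow> real) \<Rightarrow> ('v \<Rightarrow> 'u \<Rightarrow> 'v) \<Rightarrow> 'v \<Rightarrow> 'v dual \<Rightarrow> 'u \<Rightarrow> real" where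
  "H_hat Cd fd q p u = blinfun_apply p (fd q u) - Cd q u"

definition S_hat ::
  "('v::euclidean_space \<Rightarrow> 'u \<Rightarrow> real) \<Rightarrow> ('v \<Rightarrow> 'u \<Rightarrow> 'v) \<Rightarrow> nat
     \<Rightarrow> (nat \<Rightarrow> 'v) \<Rightarrow> (nat \<Rightarrow> 'v dual) \<Rightarrow> (nat \<Rightarrow> 'u) \<Rightarrow> real" where
  "S_hat Cd fd N q p u =
     (\<Sum>k<N. blinfun_apply (p (Suc k)) (q (Suc k)) - H_hat Cd fd (q k) (p (Suc k)) (u k))"

(* D_3 of H_hat vanishes at u; for open U the derivative within U is the ordinary one. *)
definition stationary ::
  "('v::euclidean_space \<Rightarrow> 'u::euclidean_space \<Rightarrow> real) \<Rightarrow> ('v \<Rightarrow> 'u \<Rightarrow> 'v) \<Rightarrow> 'u set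
     \<Rightarrow> 'v \<Rightarrow> 'v dual \<Rightarrow> 'u \<Rightarrow> bool" where
  "stationary Cd fd U q p u \<longleftrightarrow>
     u \<in> U \<and> (H_hat Cd fd q p has_derivative (\<lambda>_. 0)) (at u within U)"

definition u_star ::
  "('v::euclidean_space \<Rightarrow> 'u::euclidean_space \<Rightarrow> real) \<Rightarrow> ('v \<Rightarrow> 'u \<Rightarrow> 'v) \<Rightarrow> 'u set
     \<Rightarrow> 'v \<Rightarrow> 'v dual \<Rightarrow> 'u" where
  "u_star Cd fd U q p = (THE u. stationary Cd fd U q p u)"

definition H_plus ::
  "('v::euclidean_space \<Rightarrow> 'u \<Rightarrow> real) \<Rightarrow> ('v \<Rightarrow> 'u \<Rightarrow> 'v) \<Rightarrow> 'u set \<Rightarrow> 'v \<Rightarrow> 'v dual \<Rightarrow> real" where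
  "H_plus Cd fd U q p = (SUP u\<in>U. H_hat Cd fd q p u)"

(* The stationarity condition has a unique solution, and the supremum in H_plus is a maximum
   attained there, so that H_plus q p = p . fd q (u_star q p) - Cd q (u_star q p). *)
definition regular ::
  "('v::euclidean_space \<Rightarrow> 'u::euclidean_space \<Rightarrow> real) \<Rightarrow> ('v \<Rightarrow> 'u \<Rightarrow> 'v) \<Rightarrow> 'u set \<Rightarrow> bool" where
  "regular Cd fd U \<longleftrightarrow>
     (\<forall>q p. (\<exists>!u. stationary Cd fd U q p u) \<and>
        (\<forall>u\<in>U. H_hat Cd fd q p u \<le> H_hat Cd fd q p (u_star Cd fd U q p)))"

(* v = D_2 H_plus(q, p): the derivative is an element of V**, identified with V by evaluation. *)
definition is_D2_H_plus ::
  "('v::euclidean_space \<Rightarrow> 'u \<Rightarrow> real) \<Rightarrow> ('v \<Rightarrow> 'u \<Rightarrow> 'v) \<Rightarrow> 'u set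
     \<Rightarrow> 'v \<Rightarrow> 'v dual \<Rightarrow> 'v \<Rightarrow> bool" where
  "is_D2_H_plus Cd fd U q p v \<longleftrightarrow>
     (H_plus Cd fd U q has_derivative (\<lambda>\<pi>. blinfun_apply \<pi> v)) (at p)"

(* Costates carry the indices 1..N, so the equation for p_k starts at k = 1. *)
definition right_hamilton ::
  "('v::euclidean_space \<Rightarrow> 'u \<Rightarrow> real) \<Rightarrow> ('v \<Rightarrow> 'u \<Rightarrow> 'v) \<Rightarrow> 'u set \<Rightarrow> nat
     \<Rightarrow> (nat \<Rightarrow> 'v) \<Rightarrow> (nat \<Rightarrow> 'v dual) \<Rightarrow> bool" where
  "right_hamilton Cd fd U N q p \<longleftrightarrow>
     (\<forall>k<N. is_D2_H_plus Cd fd U (q k) (p (Suc k)) (q (Suc k))) \<and>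
     (\<forall>k\<in>{1..<N}. ((\<lambda>x. H_plus Cd fd U x (p (Suc k))) has_derivative blinfun_apply (p k)) (at (q k)))"

definition optimal_controls ::
  "('v::euclidean_space \<Rightarrow> 'u::euclidean_space \<Rightarrow> real) \<Rightarrow> ('v \<Rightarrow> 'u \<Rightarrow> 'v) \<Rightarrow> 'u set
     \<Rightarrow> (nat \<Rightarrow> 'v) \<Rightarrow> (nat \<Rightarrow> 'v dual) \<Rightarrow> nat \<Rightarrow> 'u" where
  "optimal_controls Cd fd U q p k = u_star Cd fd U (q k) (p (Suc k))"

(* A solution of the right discrete Hamilton equations from x to y in N steps whose controls
   u_k = u_star (q_k, p_(k+1)) are the optimal ones for these end points.  Stationarity of H_hat
   alone does not entail optimality: with fd q u = q + u, Cd q u = u^2/2 - 3 q^2/2 on the real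
   line there is exactly one extremal for N = 2 and given end points, but the cost has no
   minimum. *)
definition optimal_extremal ::
  "('v::euclidean_space \<Rightarrow> 'u::euclidean_space \<Rightarrow> real) \<Rightarrow> ('v \<Rightarrow> 'u \<Rightarrow> 'v) \<Rightarrow> 'u set \<Rightarrow> nat
     \<Rightarrow> 'v \<Rightarrow> 'v \<Rightarrow> (nat \<Rightarrow> 'v) \<Rightarrow> (nat \<Rightarrow> 'v dual) \<Rightarrow> bool" where
  "optimal_extremal Cd fd U N x y q p \<longleftrightarrow>
     q 0 = x \<and> q N = y \<and> right_hamilton Cd fd U N q p \<and>
     optimal Cd fd U N q (optimal_controls Cd fd U q p)"

definition action_sum ::
  "('v::euclidean_space \<Rightarrow> 'u \<Rightarrow> real) \<Rightarrow> ('v \<Rightarrow> 'u \<Rightarrow> 'v) \<Rightarrow> 'u set \<Rightarrow> nat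
     \<Rightarrow> (nat \<Rightarrow> 'v) \<Rightarrow> (nat \<Rightarrow> 'v dual) \<Rightarrow> real" where
  "action_sum Cd fd U k q p =
     (\<Sum>l<k. blinfun_apply (p (Suc l)) (q (Suc l)) - H_plus Cd fd U (q l) (p (Suc l)))"

definition S_star ::
  "('v::euclidean_space \<Rightarrow> 'u::euclidean_space \<Rightarrow> real) \<Rightarrow> ('v \<Rightarrow> 'u \<Rightarrow> 'v) \<Rightarrow> 'u set \<Rightarrow> nat
     \<Rightarrow> (nat \<Rightarrow> 'v) \<Rightarrow> (nat \<Rightarrow> 'v dual) \<Rightarrow> real" where
  "S_star Cd fd U N q p = S_hat Cd fd N q p (optimal_controls Cd fd U q p)"

definition cost_to_go ::
  "('v::euclidean_space \<Rightarrow> 'u::euclidean_space \<Rightarrow> real) \<Rightarrow> ('v \<Rightarrow> 'u \<Rightarrow> 'v) \<Rightarrow> 'u set \<Rightarrow> nat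
     \<Rightarrow> (nat \<Rightarrow> 'v) \<Rightarrow> (nat \<Rightarrow> 'v dual) \<Rightarrow> (nat \<Rightarrow> 'v \<Rightarrow> real) \<Rightarrow> nat \<Rightarrow> 'v \<Rightarrow> real" where
  "cost_to_go Cd fd U N q p S k x = S_star Cd fd U N q p - S k x"

lemma H_plus_eq_H_hat_u_star:
  assumes "regular Cd fd U"
  shows "H_plus Cd fd U q p = H_hat Cd fd q p (u_star Cd fd U q p)"
proof -
  have "stationary Cd fd U q p (u_star Cd fd U q p)"
    using assms unfolding regular_def u_star_def by (metis theI')
  then have "u_star Cd fd U q p \<in> U"
    by (simp add: stationary_def)
  then show ?thesis
    using assms unfolding H_plus_def regular_def by (intro cSup_eq_maximum) auto
qed

(* Along the trajectory (q, p) the function cost_to_go is the tail sum of the augmented costs. *)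
lemma cost_to_go_tail_sum:
  assumes "regular Cd fd U" "k \<le> N" "S k (q k) = action_sum Cd fd U k q p"
  shows "cost_to_go Cd fd U N q p S k (q k) =
    (\<Sum>l=k..<N. Cd (q l) (optimal_controls Cd fd U q p l) +
       blinfun_apply (p (Suc l)) (q (Suc l) - fd (q l) (optimal_controls Cd fd U q p l)))"
proof -
  let ?t = "\<lambda>l. blinfun_apply (p (Suc l)) (q (Suc l)) - H_plus Cd fd U (q l) (p (Suc l))"
  have "sum ?t {..<N} = sum ?t {..<k} + sum ?t {k..<N}"
    using sum.atLeastLessThan_concat[of 0 k N ?t] assms(2) by (simp add: lessThan_atLeast0)
  then have "cost_to_go Cd fd U N q p S k (q k) = sum ?t {k..<N}"
    using assms(3)
    by (simp add: cost_to_go_def S_star_def S_hat_def action_sum_def optimal_controls_def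
        H_plus_eq_H_hat_u_star[OF assms(1)])
  then show ?thesis
    by (simp add: H_plus_eq_H_hat_u_star[OF assms(1)] H_hat_def optimal_controls_def
        blinfun.diff_right algebra_simps)
qed

definition is_minimum_over :: "'u set \<Rightarrow> ('u \<Rightarrow> real) \<Rightarrow> real \<Rightarrow> bool" where
  "is_minimum_over U g m \<longleftrightarrow> (\<exists>u\<in>U. g u = m) \<and> (\<forall>u\<in>U. m \<le> g u)"

end

theory Submission
  imports Defs
begin

text \<open>
  Along an optimal extremal the action sum collapses to the running cost, so \<open>S k x\<close> is the least
  cost of steering \<open>q0\<close> to \<open>x\<close> in \<open>k\<close> steps. Appending a step with control \<open>u\<close> to an optimal
  trajectory ending at \<open>x\<close> gives \<open>S (Suc k) (fd x u) \<le> S k x + Cd x u\<close>, which is the lower bound in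
  the Bellman equation. By the envelope theorem \<open>fp k x = fd x u\<close> for the control \<open>u\<close> that maximises
  the Hamiltonian at the costate \<open>D (S (Suc k)) (fp k x)\<close>; substituting this, the Hamilton--Jacobi
  equation says precisely that this \<open>u\<close> attains the bound.
\<close>

lemma u_star_mem:
  assumes "regular Cd fd U"
  shows "u_star Cd fd U q p \<in> U"
proof -
  have "stationary Cd fd U q p (u_star Cd fd U q p)"
    using assms unfolding regular_def u_star_def by (metis theI')
  then show ?thesis
    by (simp add: stationary_def)
qed

lemma H_hat_le_H_plus:
  assumes "regular Cd fd U" "u \<in> U"
  shows "H_hat Cd fd q p u \<le> H_plus Cd fd U q p"
  using assms by (simp add: H_plus_eq_H_hat_u_star regular_def)

text \<open>Envelope theorem: with the control frozen at its value for \<open>p\<close>,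
  \<open>H_hat\<close> is affine in the costate and touches \<open>H_plus\<close> from below at
  \<open>p\<close>, so the two derivatives there agree.\<close>

lemma D2_H_plus_eq:
  fixes fd :: "'v::euclidean_space \<Rightarrow> 'u::euclidean_space \<Rightarrow> 'v"
  assumes reg: "regular Cd fd U" and D2: "is_D2_H_plus Cd fd U q p v"
  shows "v = fd q (u_star Cd fd U q p)"
proof -
  let ?u = "u_star Cd fd U q p"
  let ?g = "\<lambda>\<pi>. H_plus Cd fd U q \<pi> - H_hat Cd fd q \<pi> ?u"
  have "(?g has_derivative (\<lambda>\<pi>. blinfun_apply \<pi> v - blinfun_apply \<pi> (fd q ?u))) (at p)"
    using D2 unfolding is_D2_H_plus_def H_hat_def
    by (auto intro!: derivative_eq_intros)
  \<comment> \<open>\<open>?g\<close> is nonnegative and vanishes at \<open>p\<close>.\<close>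
  moreover have "\<forall>\<^sub>F \<pi> in at p. ?g p \<le> ?g \<pi>"
    using H_hat_le_H_plus[OF reg u_star_mem[OF reg]] H_plus_eq_H_hat_u_star[OF reg, of q p] by simp
  ultimately have "(\<lambda>\<pi>::'v dual. blinfun_apply \<pi> v - blinfun_apply \<pi> (fd q ?u)) = (\<lambda>\<pi>. 0)"
    by (rule has_derivative_local_min)
  \<comment> \<open>Testing with the costate \<open>blinfun_inner_left (v - fd q ?u)\<close> turns
    equality of the pairings into a vanishing squared norm.\<close>
  then have "blinfun_apply (blinfun_inner_left (v - fd q ?u)) (v - fd q ?u) = 0"
    by (metis blinfun.diff_right)
  then show ?thesis
    by simp
qed

text \<open>The dynamics make the costate pairings cancel in each summand, so only \<open>Cd\<close>
  remains.\<close>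

lemma action_sum_eq_total_cost:
  assumes reg: "regular Cd fd U" and adm: "admissible fd U k q (optimal_controls Cd fd U q p)"
  shows "action_sum Cd fd U k q p = total_cost Cd k q (optimal_controls Cd fd U q p)"
  using adm unfolding action_sum_def total_cost_def admissible_def
  by (auto intro!: sum.cong simp: H_plus_eq_H_hat_u_star[OF reg] H_hat_def optimal_controls_def)

lemma admissible_snoc:
  assumes "admissible fd U k q u" "q k = x" "w \<in> U"
  shows "admissible fd U (Suc k) (q(Suc k := fd x w)) (u(k := w))"
  using assms by (auto simp: admissible_def less_Suc_eq)

lemma total_cost_snoc:
  assumes "q k = x"
  shows "total_cost Cd (Suc k) (q(Suc k := y)) (u(k := w)) = total_cost Cd k q u + Cd x w"
  using assms by (simp add: total_cost_def)

lemma reachable_Suc: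
  assumes "x \<in> reachable fd U q0 k" "w \<in> U"
  shows "fd x w \<in> reachable fd U q0 (Suc k)"
proof -
  obtain q u where "admissible fd U k q u" "q 0 = q0" "q k = x"
    using assms(1) by (auto simp: reachable_def)
  then show ?thesis
    using admissible_snoc[of fd U k q u x w] assms(2) unfolding reachable_def
    by (auto intro!: exI[of _ "q(Suc k := fd x w)"])
qed

lemma optimal_extremal_cost_Suc_le:
  assumes reg: "regular Cd fd U"
    and ext: "optimal_extremal Cd fd U k x0 x q p"
    and ext': "optimal_extremal Cd fd U (Suc k) x0 (fd x w) q' p'"
    and w: "w \<in> U"
  shows "action_sum Cd fd U (Suc k) q' p' \<le> action_sum Cd fd U k q p + Cd x w"
proof -
  let ?u = "optimal_controls Cd fd U q p" and ?u' = "optimal_controls Cd fd U q' p'"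
  have q: "q 0 = x0" "q k = x" "admissible fd U k q ?u"
    and q': "q' 0 = x0" "q' (Suc k) = fd x w" "optimal Cd fd U (Suc k) q' ?u'"
    using ext ext' by (auto simp: optimal_extremal_def optimal_def)
  \<comment> \<open>The extended trajectory shares both end points with \<open>q'\<close>, so it
    competes in the minimality of \<open>q'\<close>.\<close>
  have "total_cost Cd (Suc k) q' ?u' \<le> total_cost Cd (Suc k) (q(Suc k := fd x w)) (?u(k := w))"
    using q' q admissible_snoc[OF q(3,2) w] unfolding optimal_def by auto
  also have "\<dots> = total_cost Cd k q ?u + Cd x w"
    by (rule total_cost_snoc) (rule q(2))
  finally show ?thesis
    using q(3) q'(3) by (simp add: action_sum_eq_total_cost[OF reg] optimal_def)
qed

theorem proposition6p3:
  fixes Cd :: "'v::euclidean_space \<Rightarrow> 'u::euclidean_space \<Rightarrow> real"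
    and fd :: "'v \<Rightarrow> 'u \<Rightarrow> 'v"
    and U :: "'u set"
    and N :: nat
    and q0 qN :: 'v
    and qd :: "nat \<Rightarrow> 'v" and pd :: "nat \<Rightarrow> 'v dual"
    and S :: "nat \<Rightarrow> 'v \<Rightarrow> real"
    and fp :: "nat \<Rightarrow> 'v \<Rightarrow> 'v"
  assumes regular: "regular Cd fd U"
    and extremal: "optimal_extremal Cd fd U N q0 qN qd pd"
    and action_sums: "\<And>k x. k \<le> N \<Longrightarrow> x \<in> reachable fd U q0 k \<Longrightarrow>
          \<exists>q p. optimal_extremal Cd fd U k q0 x q p \<and> S k x = action_sum Cd fd U k q p"
    and S_diff: "\<And>k x. k < N \<Longrightarrow> x \<in> reachable fd U q0 k \<Longrightarrow>
          S (Suc k) differentiable (at (fp k x))"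
    and f_plus: "\<And>k x. k < N \<Longrightarrow> x \<in> reachable fd U q0 k \<Longrightarrow>
          is_D2_H_plus Cd fd U x (D (S (Suc k)) (fp k x)) (fp k x)"
    and right_hamilton_jacobi: "\<And>k x. k < N \<Longrightarrow> x \<in> reachable fd U q0 k \<Longrightarrow>
          S (Suc k) (fp k x) - S k x - blinfun_apply (D (S (Suc k)) (fp k x)) (fp k x)
            + H_plus Cd fd U x (D (S (Suc k)) (fp k x)) = 0"
  shows "\<forall>k<N. \<forall>x\<in>reachable fd U q0 k.
           is_minimum_over U
             (\<lambda>u. cost_to_go Cd fd U N qd pd S (Suc k) (fd x u) + Cd x u)
             (cost_to_go Cd fd U N qd pd S k x)"
proof (intro allI impI ballI)
  fix k x
  assume k: "k < N" and x: "x \<in> reachable fd U q0 k"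
  let ?p = "D (S (Suc k)) (fp k x)"
  let ?u = "u_star Cd fd U x ?p"
  have le: "S (Suc k) (fd x w) \<le> S k x + Cd x w" if w: "w \<in> U" for w
    using action_sums[of k x] action_sums[of "Suc k" "fd x w"] k x w
      reachable_Suc[OF x w] optimal_extremal_cost_Suc_le[OF regular _ _ w, of k q0 x]
    by fastforce
  have "fp k x = fd x ?u"
    by (rule D2_H_plus_eq[OF regular f_plus[OF k x]])
  \<comment> \<open>The pairing of \<open>?p\<close> with \<open>fp k x\<close> cancels the one
    inside \<open>H_plus\<close>.\<close>
  then have "S (Suc k) (fd x ?u) = S k x + Cd x ?u"
    using right_hamilton_jacobi[OF k x] H_plus_eq_H_hat_u_star[OF regular, of x ?p]
    by (simp add: H_hat_def)
  \<comment> \<open>\<open>cost_to_go\<close> subtracts \<open>S\<close> from a constant, so the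
    upper bound \<open>le\<close> on \<open>S (Suc k)\<close> becomes the lower bound required
    here.\<close>
  then show "is_minimum_over U
      (\<lambda>u. cost_to_go Cd fd U N qd pd S (Suc k) (fd x u) + Cd x u)
      (cost_to_go Cd fd U N qd pd S k x)"
    using le u_star_mem[OF regular, of x ?p] unfolding is_minimum_over_def cost_to_go_def
    by (force simp: algebra_simps)
qed

end
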